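(* Let $\mathcal{U}=\begin{bmatrix}\mathcal{A}&\mathcal{M}\\ \mathcal{N}&\mathcal{B}\end{bmatrix}$ be a unital generalized matrix algebra. A linear map $\phi:\mathcal{U}\to\mathcal{U}$ is a Lie triple centralizer if and only if $\phi$ has the form $$\phi\left(\begin{bmatrix}a&m\\ n&b\end{bmatrix}\right)=\begin{bmatrix}\alpha_1(a)+\beta_1(b)&\tau_2(m)\\ \gamma_3(n)&\alpha_4(a)+\beta_4(b)\end{bmatrix}\qquad (a\in\mathcal{A},\,m\in\mathcal{M},\,n\in\mathcal{N},\,b\in\mathcal{B}),$$ where $\alpha_1:\mathcal{A}\to\mathcal{A}$, $\beta_1:\mathcal{B}\to[\mathcal{A},\mathcal{A}]'$, $\tau_2:\mathcal{M}\to\mathcal{M}$, $\alpha_4:\mathcal{A}\to[\mathcal{B},\mathcal{B}]'$, $\beta_4:\mathcal{B}\to\mathcal{B}$ and $\gamma_3:\mathcal{N}\to\mathcal{N}$ are linear mappings satisfying the following conditions: (i) $\alpha_1$ is a Lie triple centralizer on $\mathcal{A}$; $[[\alpha_4(a),b_1],b_2]=0$ for all $a\in\mathcal{A}$, $b_1,b_2\in\mathcal{B}$; $\alpha_4([[a_1,a_2],a_3])=0$ for all $a_1,a_2,a_3\in\mathcal{A}$; and $$\alpha_1(mn)-\beta_1(nm)=\tau_2(m)n=m\gamma_3(n)\qquad(m\in\mathcal{M},\,n\in\mathcal{N}).$$ (ii) $\beta_4$ is a Lie triple centralizer on $\mathcal{B}$; $[[\beta_1(b),a_1],a_2]=0$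 for all $b\in\mathcal{B}$, $a_1,a_2\in\mathcal{A}$; $\beta_1([[b_1,b_2],b_3])=0$ for all $b_1,b_2,b_3\in\mathcal{B}$; and $$\beta_4(nm)-\alpha_4(mn)=n\tau_2(m)=\gamma_3(n)m\qquad(m\in\mathcal{M},\,n\in\mathcal{N}).$$ (iii) $\tau_2(am)=a\tau_2(m)=\alpha_1(a)m-m\alpha_4(a)$ and $\tau_2(mb)=\tau_2(m)b=m\beta_4(b)-\beta_1(b)m$ for all $a\in\mathcal{A}$, $b\in\mathcal{B}$, $m\in\mathcal{M}$. (iv) $\gamma_3(na)=\gamma_3(n)a=n\alpha_1(a)-\alpha_4(a)n$ and $\gamma_3(bn)=b\gamma_3(n)=\beta_4(b)n-n\beta_1(b)$ for all $a\in\mathcal{A}$, $b\in\mathcal{B}$, $n\in\mathcal{N}$.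
   Context: All algebras (associative) and modules are over a unital commutative ring $\mathcal{R}$, and linear means $\mathcal{R}$-linear. $[x,y]=xy-yx$. A Morita context consists of algebras $\mathcal{A},\mathcal{B}$, an $(\mathcal{A},\mathcal{B})$-bimodule $\mathcal{M}$, a $(\mathcal{B},\mathcal{A})$-bimodule $\mathcal{N}$, and bimodule homomorphisms $\mathcal{M}\otimes_{\mathcal{B}}\mathcal{N}\to\mathcal{A}$, $m\otimes n\mapsto mn$, and $\mathcal{N}\otimes_{\mathcal{A}}\mathcal{M}\to\mathcal{B}$, $n\otimes m\mapsto nm$, satisfying $(mn)m'=m(nm')$ and $(nm)n'=n(mn')$ for all $m,m'\in\mathcal{M}$, $n,n'\in\mathcal{N}$. The set $\mathcal{U}=\begin{bmatrix}\mathcal{A}&\mathcal{M}\\ \mathcal{N}&\mathcal{B}\end{bmatrix}$ of all matrices $\begin{bmatrix}a&m\\ n&b\end{bmatrix}$ ($a\in\mathcal{A}$, $m\in\mathcal{M}$, $n\in\mathcal{N}$, $b\in\mathcal{B}$), with the usual matrix operations, is an algebra called a generalized matrix algebra. It is unital exactly when $\mathcal{A},\mathcal{B}$ are unital with identities $1_{\mathcal{A}},1_{\mathcal{B}}$ and $\mathcal{M},\mathcal{N}$ are unital bimodules ($1_{\mathcal{A}}m=m=m1_{\mathcal{B}}$, $1_{\mathcal{B}}n=n=n1_{\mathcal{A}}$). A linear map $\phi:\mathcal{G}\to\mathcal{G}$ on an algebra $\mathcal{G}$ is a Lie triple centralizer if $\phi([[a,b],c])=[[\phi(a),b],c]$ for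 all $a,b,c\in\mathcal{G}$. For a subset $\mathcal{C}$ of an algebra $\mathcal{G}$, $\mathcal{C}'=\{g\in\mathcal{G}: gc=cg\text{ for all }c\in\mathcal{C}\}$ is its commutant in $\mathcal{G}$. Thus $[\mathcal{A},\mathcal{A}]'$ is the commutant in $\mathcal{A}$ of the commutators of $\mathcal{A}$, and $[\mathcal{B},\mathcal{B}]'$ is the commutant in $\mathcal{B}$ of the commutators of $\mathcal{B}$. *)

theory Defs
  imports Complex_Main "HOL-Library.Product_Plus"
begin

text \<open>
  The scalars form a type \<open>'r :: comm_ring_1\<close>; modules are instances of the locale
  \<^locale>\<open>module\<close> and linear maps are instances of \<^locale>\<open>module_hom\<close>. The
  multiplication of an algebra is an explicit parameter, because the multiplication of a
  generalized matrix algebra depends on the bimodule actions and pairings and so cannot be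
  a type class operation.
\<close>

definition bilinear_map ::
  "('r::comm_ring_1 \<Rightarrow> 'x::ab_group_add \<Rightarrow> 'x) \<Rightarrow> ('r \<Rightarrow> 'y::ab_group_add \<Rightarrow> 'y) \<Rightarrow>
   ('r \<Rightarrow> 'z::ab_group_add \<Rightarrow> 'z) \<Rightarrow> ('x \<Rightarrow> 'y \<Rightarrow> 'z) \<Rightarrow> bool"
  where "bilinear_map s1 s2 s3 f \<longleftrightarrow>
    (\<forall>x. module_hom s2 s3 (f x)) \<and> (\<forall>y. module_hom s1 s3 (\<lambda>x. f x y))"

text \<open>Associative algebras, not assumed to have an identity.\<close>

locale assoc_algebra = module scale
  for scale :: "'r::comm_ring_1 \<Rightarrow> 'g::ab_group_add \<Rightarrow> 'g" +
  fixes mult :: "'g \<Rightarrow> 'g \<Rightarrow> 'g"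
  assumes mult_bilinear: "bilinear_map scale scale scale mult"
    and mult_assoc: "mult (mult x y) z = mult x (mult y z)"

definition has_identity :: "('g \<Rightarrow> 'g \<Rightarrow> 'g) \<Rightarrow> bool"
  where "has_identity mult \<longleftrightarrow> (\<exists>e. \<forall>x. mult e x = x \<and> mult x e = x)"

definition commutator :: "('g::ab_group_add \<Rightarrow> 'g \<Rightarrow> 'g) \<Rightarrow> 'g \<Rightarrow> 'g \<Rightarrow> 'g"
  where "commutator mult x y = mult x y - mult y x"

definition commutators :: "('g::ab_group_add \<Rightarrow> 'g \<Rightarrow> 'g) \<Rightarrow> 'g set"
  where "commutators mult = {commutator mult x y | x y. True}"

definition commutant :: "('g \<Rightarrow> 'g \<Rightarrow> 'g) \<Rightarrow> 'g set \<Rightarrow> 'g set"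
  where "commutant mult C = {g. \<forall>c\<in>C. mult g c = mult c g}"

definition lie_triple_centralizer ::
  "('r::comm_ring_1 \<Rightarrow> 'g::ab_group_add \<Rightarrow> 'g) \<Rightarrow> ('g \<Rightarrow> 'g \<Rightarrow> 'g) \<Rightarrow> ('g \<Rightarrow> 'g) \<Rightarrow> bool"
  where "lie_triple_centralizer scale mult \<phi> \<longleftrightarrow>
    module_hom scale scale \<phi> \<and>
    (\<forall>a b c. \<phi> (commutator mult (commutator mult a b) c) =
             commutator mult (commutator mult (\<phi> a) b) c)"

text \<open>
  Bimodules are not assumed to be unital. The type class \<^class>\<open>ring\<close> has no
  identity, so the zero algebra is allowed for \<open>'a\<close> and \<open>'b\<close>.
\<close>

locale bimodule =
  A: assoc_algebra scaleA "(*)" + B: assoc_algebra scaleB "(*)" + M: module scaleM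
  for scaleA :: "'r::comm_ring_1 \<Rightarrow> 'a::ring \<Rightarrow> 'a"
    and scaleB :: "'r \<Rightarrow> 'b::ring \<Rightarrow> 'b"
    and scaleM :: "'r \<Rightarrow> 'm::ab_group_add \<Rightarrow> 'm" +
  fixes lact :: "'a \<Rightarrow> 'm \<Rightarrow> 'm" and ract :: "'m \<Rightarrow> 'b \<Rightarrow> 'm"
  assumes lact_bilinear: "bilinear_map scaleA scaleM scaleM lact"
    and ract_bilinear: "bilinear_map scaleM scaleB scaleM ract"
    and lact_assoc: "lact (a * a') m = lact a (lact a' m)"
    and ract_assoc: "ract m (b * b') = ract (ract m b) b'"
    and lact_ract: "ract (lact a m) b = lact a (ract m b)"

text \<open>
  A bimodule homomorphism from the tensor product of \<open>M\<close> and \<open>N\<close> over \<open>B\<close> to \<open>A\<close> is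
  given, via the universal property, by the bilinear map \<open>mn\<close> which is \<open>B\<close>-balanced and
  compatible with the two outer actions of \<open>A\<close>; similarly for \<open>nm\<close>.
\<close>

locale morita_context =
  M: bimodule scaleA scaleB scaleM lM rM + N: bimodule scaleB scaleA scaleN lN rN
  for scaleA :: "'r::comm_ring_1 \<Rightarrow> 'a::ring \<Rightarrow> 'a"
    and scaleB :: "'r \<Rightarrow> 'b::ring \<Rightarrow> 'b"
    and scaleM :: "'r \<Rightarrow> 'm::ab_group_add \<Rightarrow> 'm"
    and scaleN :: "'r \<Rightarrow> 'n::ab_group_add \<Rightarrow> 'n"
    and lM :: "'a \<Rightarrow> 'm \<Rightarrow> 'm" and rM :: "'m \<Rightarrow> 'b \<Rightarrow> 'm"
    and lN :: "'b \<Rightarrow> 'n \<Rightarrow> 'n" and rN :: "'n \<Rightarrow> 'a \<Rightarrow> 'n" +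
  fixes mn :: "'m \<Rightarrow> 'n \<Rightarrow> 'a" and nm :: "'n \<Rightarrow> 'm \<Rightarrow> 'b"
  assumes mn_bilinear: "bilinear_map scaleM scaleN scaleA mn"
    and mn_balanced: "mn (rM m b) n = mn m (lN b n)"
    and mn_left: "mn (lM a m) n = a * mn m n"
    and mn_right: "mn m (rN n a) = mn m n * a"
    and nm_bilinear: "bilinear_map scaleN scaleM scaleB nm"
    and nm_balanced: "nm (rN n a) m = nm n (lM a m)"
    and nm_left: "nm (lN b n) m = b * nm n m"
    and nm_right: "nm n (rM m b) = nm n m * b"
    and mnm: "lM (mn m n) m' = rM m (nm n m')"
    and nmn: "lN (nm n m) n' = rN n (mn m n')"

text \<open>
  The matrix with rows \<open>a, m\<close> and \<open>n, b\<close> is encoded as the tuple \<open>(a, m, n, b)\<close>;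
  addition is the componentwise addition of tuples.
\<close>

fun gm_scale ::
  "('r \<Rightarrow> 'a \<Rightarrow> 'a) \<Rightarrow> ('r \<Rightarrow> 'b \<Rightarrow> 'b) \<Rightarrow> ('r \<Rightarrow> 'm \<Rightarrow> 'm) \<Rightarrow> ('r \<Rightarrow> 'n \<Rightarrow> 'n) \<Rightarrow>
   'r \<Rightarrow> 'a \<times> 'm \<times> 'n \<times> 'b \<Rightarrow> 'a \<times> 'm \<times> 'n \<times> 'b"
  where "gm_scale scaleA scaleB scaleM scaleN r (a, m, n, b) =
    (scaleA r a, scaleM r m, scaleN r n, scaleB r b)"

fun gm_mult ::
  "('a::ring \<Rightarrow> 'm::ab_group_add \<Rightarrow> 'm) \<Rightarrow> ('m \<Rightarrow> 'b::ring \<Rightarrow> 'm) \<Rightarrow>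
   ('b \<Rightarrow> 'n::ab_group_add \<Rightarrow> 'n) \<Rightarrow> ('n \<Rightarrow> 'a \<Rightarrow> 'n) \<Rightarrow>
   ('m \<Rightarrow> 'n \<Rightarrow> 'a) \<Rightarrow> ('n \<Rightarrow> 'm \<Rightarrow> 'b) \<Rightarrow>
   'a \<times> 'm \<times> 'n \<times> 'b \<Rightarrow> 'a \<times> 'm \<times> 'n \<times> 'b \<Rightarrow> 'a \<times> 'm \<times> 'n \<times> 'b"
  where "gm_mult lM rM lN rN mn nm (a, m, n, b) (a', m', n', b') =
    (a * a' + mn m n', lM a m' + rM m b', rN n a' + lN b n', nm n m' + b * b')"

context morita_context
begin

lemma gm_assoc_algebra:
  "assoc_algebra (gm_scale scaleA scaleB scaleM scaleN) (gm_mult lM rM lN rN mn nm)"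
proof -
  note bil = M.A.mult_bilinear M.B.mult_bilinear M.lact_bilinear M.ract_bilinear
    N.lact_bilinear N.ract_bilinear mn_bilinear nm_bilinear
  note add = bil[unfolded bilinear_map_def, THEN conjunct1, rule_format, THEN module_hom.add]
    bil[unfolded bilinear_map_def, THEN conjunct2, rule_format, THEN module_hom.add]
  note scl = bil[unfolded bilinear_map_def, THEN conjunct1, rule_format, THEN module_hom.scale]
    bil[unfolded bilinear_map_def, THEN conjunct2, rule_format, THEN module_hom.scale]
  note sright = M.A.scale_right_distrib M.B.scale_right_distrib
    M.M.scale_right_distrib N.M.scale_right_distrib
  note sleft = M.A.scale_left_distrib M.B.scale_left_distrib
    M.M.scale_left_distrib N.M.scale_left_distrib
  have mod: "module (gm_scale scaleA scaleB scaleM scaleN)"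
    by unfold_locales (auto simp: sright sleft)
  have bilU: "bilinear_map (gm_scale scaleA scaleB scaleM scaleN)
      (gm_scale scaleA scaleB scaleM scaleN) (gm_scale scaleA scaleB scaleM scaleN)
      (gm_mult lM rM lN rN mn nm)"
    unfolding bilinear_map_def module_hom_def module_hom_axioms_def
    by (auto simp: mod add scl sright)
  have assoc: "gm_mult lM rM lN rN mn nm (gm_mult lM rM lN rN mn nm x y) z =
      gm_mult lM rM lN rN mn nm x (gm_mult lM rM lN rN mn nm y z)" for x y z
    by (cases x; cases y; cases z)
      (simp add: add mult.assoc M.lact_assoc M.ract_assoc M.lact_ract N.lact_assoc
        N.ract_assoc N.lact_ract mn_balanced mn_left mn_right nm_balanced nm_left nm_right
        mnm nmn ac_simps del: add.assoc)
  show ?thesis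
    using mod bilU assoc by (simp add: assoc_algebra_def assoc_algebra_axioms_def)
qed

lemma gm_has_identity_iff:
  "has_identity (gm_mult lM rM lN rN mn nm) \<longleftrightarrow>
    (\<exists>oneA oneB. (\<forall>a. oneA * a = a \<and> a * oneA = a) \<and> (\<forall>b. oneB * b = b \<and> b * oneB = b) \<and>
      (\<forall>m. lM oneA m = m \<and> rM m oneB = m) \<and> (\<forall>n. lN oneB n = n \<and> rN n oneA = n))"
  (is "_ \<longleftrightarrow> ?R")
proof -
  note bil = M.A.mult_bilinear M.B.mult_bilinear M.lact_bilinear M.ract_bilinear
    N.lact_bilinear N.ract_bilinear mn_bilinear nm_bilinear
  note zero = bil[unfolded bilinear_map_def, THEN conjunct1, rule_format, THEN module_hom.zero]
    bil[unfolded bilinear_map_def, THEN conjunct2, rule_format, THEN module_hom.zero]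
  show ?thesis
  proof
    assume "has_identity (gm_mult lM rM lN rN mn nm)"
    then obtain e1 e2 e3 e4 where e: "\<And>x. gm_mult lM rM lN rN mn nm (e1, e2, e3, e4) x = x"
      "\<And>x. gm_mult lM rM lN rN mn nm x (e1, e2, e3, e4) = x"
      unfolding has_identity_def by (metis prod_cases4)
    have "e1 * a = a \<and> a * e1 = a" for a
      using e(1)[of "(a, 0, 0, 0)"] e(2)[of "(a, 0, 0, 0)"] by (simp add: zero)
    moreover have "e4 * b = b \<and> b * e4 = b" for b
      using e(1)[of "(0, 0, 0, b)"] e(2)[of "(0, 0, 0, b)"] by (simp add: zero)
    moreover have "lM e1 m = m \<and> rM m e4 = m" for m
      using e(1)[of "(0, m, 0, 0)"] e(2)[of "(0, m, 0, 0)"] by (simp add: zero)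
    moreover have "lN e4 n = n \<and> rN n e1 = n" for n
      using e(1)[of "(0, 0, n, 0)"] e(2)[of "(0, 0, n, 0)"] by (simp add: zero)
    ultimately show ?R by blast
  next
    assume ?R
    then obtain oneA oneB where
      "\<forall>a. oneA * a = a \<and> a * oneA = a" "\<forall>b. oneB * b = b \<and> b * oneB = b"
      "\<forall>m. lM oneA m = m \<and> rM m oneB = m" "\<forall>n. lN oneB n = n \<and> rN n oneA = n"
      by blast
    then show "has_identity (gm_mult lM rM lN rN mn nm)"
      unfolding has_identity_def by (intro exI[of _ "(oneA, 0, 0, oneB)"]) (auto simp: zero)
  qed
qed

end

end

theory Submission imports Defs
begin

text \<open>
  Write \<open>\<U>\<close> for the generalized matrix algebra, \<open>e\<close> and \<open>f\<close> for the diagonal idempotents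
  \<open>1\<^sub>A\<close> and \<open>1\<^sub>B\<close>, and \<open>[x, y, z]\<close> for \<open>[[x, y], z]\<close>.

  Necessity. A Lie triple centralizer \<open>\<phi>\<close> can be moved into any of the three slots of
  \<open>[x, y, z]\<close>: into the second by antisymmetry, into the third by the Jacobi identity
  (\<open>lie_triple_centralizer_third\<close>). The map \<open>x \<mapsto> [x, f, f]\<close> is the projection onto
  the off-diagonal part, so \<open>\<phi>\<close> commutes with this projection, and diagonal matrices go to
  diagonal matrices. For \<open>m\<close> in \<open>M\<close> one has \<open>m = [e, m, f]\<close>, hence
  \<open>\<phi> m = [\<phi> e, m, f]\<close>; since \<open>\<phi> e\<close> is diagonal, this lies in \<open>M\<close> again, and likewise
  for \<open>N\<close>. This is the block form. Each of the conditions is then the identity obtained by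
  evaluating \<open>\<phi>\<close> on one elementary double commutator in two ways: on three diagonal
  entries (\<open>corner_conditions\<close>), on \<open>[m, n] = [e, m, n]\<close> (\<open>pairing_conditions\<close>), and on
  \<open>a m = [a, m, f]\<close>, \<open>m b = [m, b, f]\<close> and their analogues in \<open>N\<close>
  (\<open>action_conditions\<close>).

  Sufficiency. The conditions make \<open>\<phi>\<close> nearly a centralizer of a single bracket: the defect
  \<open>\<phi> [x, y] - [\<phi> x, y]\<close> is a diagonal matrix that depends only on the diagonals of
  \<open>x\<close> and \<open>y\<close> (\<open>block_map_bracket\<close>). Using this twice, \<open>\<phi> [x, y, z] - [\<phi> x, y, z]\<close> is
  the defect of \<open>([x, y], z)\<close> plus the bracket of the defect of \<open>(x, y)\<close> with \<open>z\<close>. The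
  diagonal entries of this sum cancel (\<open>defect_cancel\<close>), and its off-diagonal entries vanish
  because defects commute with \<open>M\<close> and \<open>N\<close> (\<open>defect_commutes\<close>). Exchanging the corners
  \<open>A\<close> and \<open>B\<close> preserves all the conditions, so only the entries in \<open>A\<close> and \<open>M\<close> need a
  computation.
\<close>

section \<open>Lie triple centralizers act in every slot\<close>

context assoc_algebra
begin

lemmas mult_hom_right = mult_bilinear[unfolded bilinear_map_def, THEN conjunct1, rule_format]
lemmas mult_hom_left = mult_bilinear[unfolded bilinear_map_def, THEN conjunct2, rule_format]
lemmas mult_diff = mult_hom_left[THEN module_hom.diff] mult_hom_right[THEN module_hom.diff]
lemmas mult_neg = mult_hom_left[THEN module_hom.neg] mult_hom_right[THEN module_hom.neg]

lemma commutator_swap: "commutator mult x y = - commutator mult y x"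
  by (simp add: commutator_def)

lemma commutator_minus_left: "commutator mult (- x) y = - commutator mult x y"
  by (simp add: commutator_def mult_neg)

text \<open>
  The Jacobi identity writes \<open>[c, [x, y]]\<close> as \<open>[[c, x], y] - [[c, y], x]\<close>. Applied to the
  values of \<open>\<beta>\<^sub>1\<close> and \<open>\<alpha>\<^sub>4\<close>, this gives the inclusions of their ranges in commutants.
\<close>

lemma commutes_with_commutators:
  assumes "\<And>x y. commutator mult (commutator mult c x) y = 0"
  shows "c \<in> commutant mult (commutators mult)"
proof -
  have "commutator mult c (commutator mult x y) =
      commutator mult (commutator mult c x) y - commutator mult (commutator mult c y) x" for x y
    by (simp add: commutator_def mult_diff mult_assoc algebra_simps)
  then have "commutator mult c (commutator mult x y) = 0" for x y
    by (simp add: assms)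
  then show ?thesis
    by (auto simp: commutant_def commutators_def commutator_def[of _ c])
qed

lemma lie_triple_centralizer_second:
  assumes "lie_triple_centralizer scale mult \<phi>"
  shows "\<phi> (commutator mult (commutator mult x y) z) = commutator mult (commutator mult x (\<phi> y)) z"
proof -
  interpret h: module_hom scale scale \<phi>
    using assms by (simp add: lie_triple_centralizer_def)
  have "\<phi> (commutator mult (commutator mult x y) z)
      = - \<phi> (commutator mult (commutator mult y x) z)"
    by (metis commutator_swap commutator_minus_left h.neg)
  also have "\<dots> = - commutator mult (commutator mult (\<phi> y) x) z"
    using assms by (simp add: lie_triple_centralizer_def)
  also have "\<dots> = commutator mult (commutator mult x (\<phi> y)) z"
    by (metis commutator_swap commutator_minus_left)
  finally show ?thesis .
qed

text \<open>
  By the Jacobi identity the third slot is a difference of double commutators in which the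
  third argument has moved inside, where the map can already be transported.
\<close>

lemma lie_triple_centralizer_third:
  assumes "lie_triple_centralizer scale mult \<phi>"
  shows "\<phi> (commutator mult (commutator mult x y) z) = commutator mult (commutator mult x y) (\<phi> z)"
proof -
  interpret h: module_hom scale scale \<phi>
    using assms by (simp add: lie_triple_centralizer_def)
  have jacobi: "commutator mult (commutator mult x y) w =
      commutator mult (commutator mult x w) y - commutator mult (commutator mult y w) x" for w
    by (simp add: commutator_def mult_diff mult_assoc algebra_simps)
  show ?thesis
    unfolding jacobi[of z] jacobi[of "\<phi> z"]
    by (simp add: h.diff lie_triple_centralizer_second[OF assms])
qed

end

section \<open>Computing in a generalized matrix algebra\<close>

context morita_context
begin

abbreviation gm_bracket where
  "gm_bracket \<equiv> commutator (gm_mult lM rM lN rN mn nm)"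

lemmas bilinear_maps = M.lact_bilinear M.ract_bilinear N.lact_bilinear N.ract_bilinear
  mn_bilinear nm_bilinear

lemmas hom_right = bilinear_maps[unfolded bilinear_map_def, THEN conjunct1, rule_format]
lemmas hom_left = bilinear_maps[unfolded bilinear_map_def, THEN conjunct2, rule_format]

lemmas pairing_add = hom_right[THEN module_hom.add] hom_left[THEN module_hom.add]
lemmas pairing_diff = hom_right[THEN module_hom.diff] hom_left[THEN module_hom.diff]
lemmas pairing_zero = hom_right[THEN module_hom.zero] hom_left[THEN module_hom.zero]
lemmas pairing_neg = hom_right[THEN module_hom.neg] hom_left[THEN module_hom.neg]

lemmas pairing_assoc = M.lact_assoc M.ract_assoc M.lact_ract N.lact_assoc N.ract_assoc N.lact_ract
  mn_balanced mn_left mn_right nm_balanced nm_left nm_right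

lemma gm_bracket_eq:
  "gm_bracket (a, m, n, b) (a', m', n', b') =
    (a * a' + mn m n' - (a' * a + mn m' n), lM a m' + rM m b' - (lM a' m + rM m' b),
     rN n a' + lN b n' - (rN n' a + lN b' n), nm n m' + b * b' - (nm n' m + b' * b))"
  by (simp add: commutator_def)

text \<open>
  The axioms are symmetric under exchanging the two corners; this halves the verification of
  sufficiency.
\<close>

lemma dual: "morita_context scaleB scaleA scaleN scaleM lN rN lM rM nm mn"
  by unfold_locales
    (simp_all add: pairing_assoc mnm nmn mn_bilinear nm_bilinear)

end

section \<open>The conditions suffice\<close>

text \<open>
  The pairing equations are oriented so that the exchange of
  the corners permutes the list of assumptions.
\<close>

locale block_lie_centralizer = morita_context scaleA scaleB scaleM scaleN lM rM lN rN mn nm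
  for scaleA :: "'r::comm_ring_1 \<Rightarrow> 'a::ring \<Rightarrow> 'a"
    and scaleB :: "'r \<Rightarrow> 'b::ring \<Rightarrow> 'b"
    and scaleM :: "'r \<Rightarrow> 'm::ab_group_add \<Rightarrow> 'm"
    and scaleN :: "'r \<Rightarrow> 'n::ab_group_add \<Rightarrow> 'n"
    and lM :: "'a \<Rightarrow> 'm \<Rightarrow> 'm" and rM :: "'m \<Rightarrow> 'b \<Rightarrow> 'm"
    and lN :: "'b \<Rightarrow> 'n \<Rightarrow> 'n" and rN :: "'n \<Rightarrow> 'a \<Rightarrow> 'n"
    and mn :: "'m \<Rightarrow> 'n \<Rightarrow> 'a" and nm :: "'n \<Rightarrow> 'm \<Rightarrow> 'b" +
  fixes \<alpha>\<^sub>1 :: "'a \<Rightarrow> 'a" and \<beta>\<^sub>1 :: "'b \<Rightarrow> 'a" and \<tau>\<^sub>2 :: "'m \<Rightarrow> 'm"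
    and \<alpha>\<^sub>4 :: "'a \<Rightarrow> 'b" and \<beta>\<^sub>4 :: "'b \<Rightarrow> 'b" and \<gamma>\<^sub>3 :: "'n \<Rightarrow> 'n"
  assumes linear_\<beta>\<^sub>1: "module_hom scaleB scaleA \<beta>\<^sub>1"
    and linear_\<tau>\<^sub>2: "module_hom scaleM scaleM \<tau>\<^sub>2"
    and linear_\<alpha>\<^sub>4: "module_hom scaleA scaleB \<alpha>\<^sub>4"
    and linear_\<gamma>\<^sub>3: "module_hom scaleN scaleN \<gamma>\<^sub>3"
    and ltc_\<alpha>\<^sub>1: "lie_triple_centralizer scaleA (*) \<alpha>\<^sub>1"
    and \<alpha>\<^sub>4_range: "commutator (*) (commutator (*) (\<alpha>\<^sub>4 a) b\<^sub>1) b\<^sub>2 = 0"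
    and \<alpha>\<^sub>4_kernel: "\<alpha>\<^sub>4 (commutator (*) (commutator (*) a\<^sub>1 a\<^sub>2) a\<^sub>3) = 0"
    and mn_\<tau>\<^sub>2: "\<alpha>\<^sub>1 (mn m n) - \<beta>\<^sub>1 (nm n m) = mn (\<tau>\<^sub>2 m) n"
    and mn_\<gamma>\<^sub>3: "mn (\<tau>\<^sub>2 m) n = mn m (\<gamma>\<^sub>3 n)"
    and ltc_\<beta>\<^sub>4: "lie_triple_centralizer scaleB (*) \<beta>\<^sub>4"
    and \<beta>\<^sub>1_range: "commutator (*) (commutator (*) (\<beta>\<^sub>1 b) a\<^sub>1) a\<^sub>2 = 0"
    and \<beta>\<^sub>1_kernel: "\<beta>\<^sub>1 (commutator (*) (commutator (*) b\<^sub>1 b\<^sub>2) b\<^sub>3) = 0"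
    and nm_\<gamma>\<^sub>3: "\<beta>\<^sub>4 (nm n m) - \<alpha>\<^sub>4 (mn m n) = nm (\<gamma>\<^sub>3 n) m"
    and nm_\<tau>\<^sub>2: "nm (\<gamma>\<^sub>3 n) m = nm n (\<tau>\<^sub>2 m)"
    and \<tau>\<^sub>2_lM: "\<tau>\<^sub>2 (lM a m) = lM a (\<tau>\<^sub>2 m)"
    and lM_\<tau>\<^sub>2: "lM a (\<tau>\<^sub>2 m) = lM (\<alpha>\<^sub>1 a) m - rM m (\<alpha>\<^sub>4 a)"
    and \<tau>\<^sub>2_rM: "\<tau>\<^sub>2 (rM m b) = rM (\<tau>\<^sub>2 m) b"
    and rM_\<tau>\<^sub>2: "rM (\<tau>\<^sub>2 m) b = rM m (\<beta>\<^sub>4 b) - lM (\<beta>\<^sub>1 b) m"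
    and \<gamma>\<^sub>3_rN: "\<gamma>\<^sub>3 (rN n a) = rN (\<gamma>\<^sub>3 n) a"
    and rN_\<gamma>\<^sub>3: "rN (\<gamma>\<^sub>3 n) a = rN n (\<alpha>\<^sub>1 a) - lN (\<alpha>\<^sub>4 a) n"
    and \<gamma>\<^sub>3_lN: "\<gamma>\<^sub>3 (lN b n) = lN b (\<gamma>\<^sub>3 n)"
    and lN_\<gamma>\<^sub>3: "lN b (\<gamma>\<^sub>3 n) = lN (\<beta>\<^sub>4 b) n - rN n (\<beta>\<^sub>1 b)"
begin

lemma linear_\<alpha>\<^sub>1: "module_hom scaleA scaleA \<alpha>\<^sub>1" and linear_\<beta>\<^sub>4: "module_hom scaleB scaleB \<beta>\<^sub>4"
  using ltc_\<alpha>\<^sub>1 ltc_\<beta>\<^sub>4 by (simp_all add: lie_triple_centralizer_def)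

lemmas block_linear = linear_\<alpha>\<^sub>1 linear_\<beta>\<^sub>1 linear_\<tau>\<^sub>2 linear_\<alpha>\<^sub>4 linear_\<beta>\<^sub>4 linear_\<gamma>\<^sub>3
lemmas block_add = block_linear[THEN module_hom.add]
lemmas block_diff = block_linear[THEN module_hom.diff]

lemma dual_block_lie_centralizer:
  "block_lie_centralizer scaleB scaleA scaleN scaleM lN rN lM rM nm mn
     \<beta>\<^sub>4 \<alpha>\<^sub>4 \<gamma>\<^sub>3 \<beta>\<^sub>1 \<alpha>\<^sub>1 \<tau>\<^sub>2"
  unfolding block_lie_centralizer_def block_lie_centralizer_axioms_def
  by (simp add: dual block_linear ltc_\<alpha>\<^sub>1 ltc_\<beta>\<^sub>4 \<alpha>\<^sub>4_range \<alpha>\<^sub>4_kernel \<beta>\<^sub>1_range \<beta>\<^sub>1_kernel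
      mn_\<tau>\<^sub>2 mn_\<gamma>\<^sub>3 nm_\<gamma>\<^sub>3 nm_\<tau>\<^sub>2
      \<tau>\<^sub>2_lM \<tau>\<^sub>2_rM \<gamma>\<^sub>3_rN \<gamma>\<^sub>3_lN lM_\<tau>\<^sub>2 rM_\<tau>\<^sub>2 rN_\<gamma>\<^sub>3 lN_\<gamma>\<^sub>3)

lemma range_\<beta>\<^sub>1: "range \<beta>\<^sub>1 \<subseteq> commutant (*) (commutators (*))"
  by (auto intro!: M.A.commutes_with_commutators simp: \<beta>\<^sub>1_range)

lemma range_\<alpha>\<^sub>4: "range \<alpha>\<^sub>4 \<subseteq> commutant (*) (commutators (*))"
  by (auto intro!: M.B.commutes_with_commutators simp: \<alpha>\<^sub>4_range)

definition block_map :: "'a \<times> 'm \<times> 'n \<times> 'b \<Rightarrow> 'a \<times> 'm \<times> 'n \<times> 'b" where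
  "block_map = (\<lambda>(a, m, n, b). (\<alpha>\<^sub>1 a + \<beta>\<^sub>1 b, \<tau>\<^sub>2 m, \<gamma>\<^sub>3 n, \<alpha>\<^sub>4 a + \<beta>\<^sub>4 b))"

text \<open>
  \<open>defectA\<close> and \<open>defectB\<close> are the two diagonal entries of
  \<open>block_map [x, y] - [block_map x, y]\<close>, where \<open>x\<close> has diagonal \<open>a, b\<close> and \<open>y\<close> has
  diagonal \<open>a', b'\<close>.
\<close>

definition defectA :: "'a \<Rightarrow> 'b \<Rightarrow> 'a \<Rightarrow> 'b \<Rightarrow> 'a" where
  "defectA a b a' b' = \<alpha>\<^sub>1 (commutator (*) a a') - commutator (*) (\<alpha>\<^sub>1 a) a'
     + \<beta>\<^sub>1 (commutator (*) b b') - commutator (*) (\<beta>\<^sub>1 b) a'"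

definition defectB :: "'a \<Rightarrow> 'b \<Rightarrow> 'a \<Rightarrow> 'b \<Rightarrow> 'b" where
  "defectB a b a' b' = \<beta>\<^sub>4 (commutator (*) b b') - commutator (*) (\<beta>\<^sub>4 b) b'
     + \<alpha>\<^sub>4 (commutator (*) a a') - commutator (*) (\<alpha>\<^sub>4 a) b'"

text \<open>
  Off the diagonal the action conditions give equality at once. On the diagonal the pairing
  conditions turn \<open>\<alpha>\<^sub>1 (m n') + \<beta>\<^sub>1 (- n' m)\<close> into \<open>\<tau>\<^sub>2 m n'\<close>, which is the
  corresponding term of \<open>[block_map x, y]\<close>, so only terms in the diagonals of \<open>x\<close> and
  \<open>y\<close> survive.
\<close>

lemma block_map_bracket:
  "block_map (gm_bracket (a, m, n, b) (a', m', n', b')) =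
    gm_bracket (block_map (a, m, n, b)) (a', m', n', b') + (defectA a b a' b', 0, 0, defectB a b a' b')"
proof -
  have 1: "\<alpha>\<^sub>1 (mn x y) = mn x (\<gamma>\<^sub>3 y) + \<beta>\<^sub>1 (nm y x)" for x y
    using mn_\<tau>\<^sub>2[of x y] mn_\<gamma>\<^sub>3[of x y] by (simp add: algebra_simps)
  have 2: "\<beta>\<^sub>4 (nm y x) = nm y (\<tau>\<^sub>2 x) + \<alpha>\<^sub>4 (mn x y)" for x y
    using nm_\<gamma>\<^sub>3[of y x] nm_\<tau>\<^sub>2[of y x] by (simp add: algebra_simps)
  have 3: "lM (\<alpha>\<^sub>1 c) x = lM c (\<tau>\<^sub>2 x) + rM x (\<alpha>\<^sub>4 c)" for c x
    using lM_\<tau>\<^sub>2[of c x] by (simp add: algebra_simps)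
  have 4: "lM (\<beta>\<^sub>1 d) x = rM x (\<beta>\<^sub>4 d) - rM (\<tau>\<^sub>2 x) d" for d x
    using rM_\<tau>\<^sub>2[of x d] by (simp add: algebra_simps)
  have 5: "rN y (\<alpha>\<^sub>1 c) = rN (\<gamma>\<^sub>3 y) c + lN (\<alpha>\<^sub>4 c) y" for c y
    using rN_\<gamma>\<^sub>3[of y c] by (simp add: algebra_simps)
  have 6: "rN y (\<beta>\<^sub>1 d) = lN (\<beta>\<^sub>4 d) y - lN d (\<gamma>\<^sub>3 y)" for d y
    using lN_\<gamma>\<^sub>3[of d y] by (simp add: algebra_simps)
  show ?thesis
    by (simp add: gm_bracket_eq block_map_def defectA_def defectB_def commutator_def
        block_add block_diff 1 2 3 4 5 6 mn_\<gamma>\<^sub>3 nm_\<tau>\<^sub>2 pairing_add \<tau>\<^sub>2_lM \<tau>\<^sub>2_rM \<gamma>\<^sub>3_rN \<gamma>\<^sub>3_lN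
        algebra_simps)
qed

text \<open>
  Balancedness gives \<open>(m b) n = m (b n)\<close> in \<open>A\<close>, so the pairing conditions for \<open>(m b, n)\<close>
  and \<open>(m, b n)\<close>, as \<open>\<tau>\<^sub>2 (m b) = \<tau>\<^sub>2 m b\<close>, differ only in the arguments \<open>n m b\<close> and \<open>b n m\<close> of \<open>\<beta>\<^sub>1\<close>.
\<close>

lemma \<beta>\<^sub>1_commutator_nm: "\<beta>\<^sub>1 (commutator (*) (nm n m) b) = 0"
proof -
  have "\<beta>\<^sub>1 (nm n (rM m b)) = \<beta>\<^sub>1 (nm (lN b n) m)"
    using mn_\<tau>\<^sub>2[of "rM m b" n] mn_\<tau>\<^sub>2[of m "lN b n"]
    by (simp add: mn_balanced \<tau>\<^sub>2_rM diff_eq_eq)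
  then show ?thesis
    by (simp add: commutator_def block_diff nm_left nm_right)
qed

text \<open>
  By the pairing condition the right-hand side is \<open>[\<tau>\<^sub>2 m n, a]\<close>. The left-hand side is the
  difference of the pairing conditions for \<open>(m, n a)\<close> and \<open>(a m, n)\<close>, in which the values
  of \<open>\<beta>\<^sub>1\<close> cancel because \<open>(n a) m = n (a m)\<close>.
\<close>

lemma \<alpha>\<^sub>1_commutator_mn:
  "\<alpha>\<^sub>1 (commutator (*) (mn m n) a) =
    commutator (*) (\<alpha>\<^sub>1 (mn m n)) a - commutator (*) (\<beta>\<^sub>1 (nm n m)) a"
proof -
  have "\<alpha>\<^sub>1 (mn m (rN n a)) - \<alpha>\<^sub>1 (mn (lM a m) n) = mn (\<tau>\<^sub>2 m) (rN n a) - mn (\<tau>\<^sub>2 (lM a m)) n"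
    using mn_\<tau>\<^sub>2[of m "rN n a"] mn_\<tau>\<^sub>2[of "lM a m" n] by (simp add: nm_balanced algebra_simps)
  also have "\<dots> = commutator (*) (mn (\<tau>\<^sub>2 m) n) a"
    by (simp add: commutator_def \<tau>\<^sub>2_lM mn_left mn_right)
  finally show ?thesis
    by (simp add: commutator_def block_diff mn_left mn_right mn_\<tau>\<^sub>2[symmetric] algebra_simps)
qed

text \<open>
  The first two arguments of the outer \<open>defectA\<close> are the diagonal entries of \<open>[x, y]\<close>.
  The contributions of \<open>m n' - m' n\<close> and \<open>n m' - n' m\<close> vanish by the two preceding
  lemmas. The rest telescopes, up to terms that vanish by the triple centralizer property of
  \<open>\<alpha>\<^sub>1\<close> and the two conditions on \<open>\<beta>\<^sub>1\<close>.
\<close>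

lemma defect_cancel:
  "defectA (commutator (*) a a' + mn m n' - mn m' n) (commutator (*) b b' + nm n m' - nm n' m) a'' b''
    + commutator (*) (defectA a b a' b') a'' = 0"
proof -
  have add: "commutator (*) (x + y) z = commutator (*) x z + commutator (*) y z"
    and diff: "commutator (*) (x - y) z = commutator (*) x z - commutator (*) y z"
    for x y z :: "'c::ring"
    by (simp_all add: commutator_def algebra_simps)
  have ltc: "\<alpha>\<^sub>1 (commutator (*) (commutator (*) a a') a'') =
      commutator (*) (commutator (*) (\<alpha>\<^sub>1 a) a') a''"
    using ltc_\<alpha>\<^sub>1 by (simp add: lie_triple_centralizer_def)
  show ?thesis
    by (simp add: defectA_def add diff block_add block_diff ltc \<beta>\<^sub>1_kernel \<beta>\<^sub>1_range
        \<alpha>\<^sub>1_commutator_mn \<beta>\<^sub>1_commutator_nm)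
qed

text \<open>
  The terms of the two defects split into four groups, according to which of \<open>a, b\<close> is
  bracketed with which of \<open>a', b'\<close>. In each group the action conditions bring in
  \<open>\<tau>\<^sub>2\<close>, and everything cancels because \<open>\<tau>\<^sub>2\<close> commutes with both actions.
\<close>

lemma defect_commutes: "lM (defectA a b a' b') m = rM m (defectB a b a' b')"
proof -
  have lM_\<alpha>\<^sub>1: "lM (\<alpha>\<^sub>1 c) x = \<tau>\<^sub>2 (lM c x) + rM x (\<alpha>\<^sub>4 c)"
    and rM_\<alpha>\<^sub>4: "rM x (\<alpha>\<^sub>4 c) = lM (\<alpha>\<^sub>1 c) x - \<tau>\<^sub>2 (lM c x)" for c x
    by (simp_all add: \<tau>\<^sub>2_lM lM_\<tau>\<^sub>2)
  have rM_\<beta>\<^sub>4: "rM x (\<beta>\<^sub>4 d) = \<tau>\<^sub>2 (rM x d) + lM (\<beta>\<^sub>1 d) x"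
    and lM_\<beta>\<^sub>1: "lM (\<beta>\<^sub>1 d) x = rM x (\<beta>\<^sub>4 d) - \<tau>\<^sub>2 (rM x d)" for d x
    by (simp_all add: \<tau>\<^sub>2_rM rM_\<tau>\<^sub>2)
  \<comment> \<open>The map to eliminate differs from group to group, so each of the two action conditions
    is used solved for either of its maps.\<close>
  note expand = commutator_def pairing_diff block_diff pairing_assoc
  have "lM (\<alpha>\<^sub>1 (commutator (*) a a') - commutator (*) (\<alpha>\<^sub>1 a) a') m =
      rM m (\<alpha>\<^sub>4 (commutator (*) a a'))"
    by (simp add: expand lM_\<alpha>\<^sub>1 pairing_add \<tau>\<^sub>2_lM)
  moreover have "lM (\<beta>\<^sub>1 (commutator (*) b b')) m =
      rM m (\<beta>\<^sub>4 (commutator (*) b b') - commutator (*) (\<beta>\<^sub>4 b) b')"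
    by (simp add: expand rM_\<beta>\<^sub>4 pairing_add \<tau>\<^sub>2_rM)
  moreover have "lM (commutator (*) (\<beta>\<^sub>1 b) a') m = 0"
    by (simp add: expand lM_\<beta>\<^sub>1 \<tau>\<^sub>2_lM)
  moreover have "rM m (commutator (*) (\<alpha>\<^sub>4 a) b') = 0"
    by (simp add: expand rM_\<alpha>\<^sub>4 \<tau>\<^sub>2_rM flip: M.lact_ract)
  ultimately show ?thesis
    by (simp add: defectA_def defectB_def pairing_add pairing_diff)
qed

lemma block_map_linear:
  "module_hom (gm_scale scaleA scaleB scaleM scaleN) (gm_scale scaleA scaleB scaleM scaleN) block_map"
proof -
  have "module (gm_scale scaleA scaleB scaleM scaleN)"
    using gm_assoc_algebra by (simp add: assoc_algebra_def)
  then show ?thesis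
    unfolding module_hom_def module_hom_axioms_def
    by (auto simp: block_map_def block_add block_linear[THEN module_hom.scale]
        M.A.scale_right_distrib M.B.scale_right_distrib)
qed

theorem lie_triple_centralizer_block_map:
  "lie_triple_centralizer (gm_scale scaleA scaleB scaleM scaleN) (gm_mult lM rM lN rN mn nm) block_map"
proof -
  interpret D: block_lie_centralizer scaleB scaleA scaleN scaleM lN rN lM rM nm mn
    \<beta>\<^sub>4 \<alpha>\<^sub>4 \<gamma>\<^sub>3 \<beta>\<^sub>1 \<alpha>\<^sub>1 \<tau>\<^sub>2
    by (rule dual_block_lie_centralizer)
  have defect_dual: "D.defectA b a b' a' = defectB a b a' b'" "D.defectB b a b' a' = defectA a b a' b'"
    for a b a' b'
    by (simp_all add: D.defectA_def D.defectB_def defectA_def defectB_def)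
  have "block_map (gm_bracket (gm_bracket x y) z) = gm_bracket (gm_bracket (block_map x) y) z"
    for x y z
  proof -
    obtain a m n b where x: "x = (a, m, n, b)" by (cases x)
    obtain a' m' n' b' where y: "y = (a', m', n', b')" by (cases y)
    obtain a'' m'' n'' b'' where z: "z = (a'', m'', n'', b'')" by (cases z)
    \<comment> \<open>\<open>p\<close> and \<open>q\<close> are the diagonal entries of \<open>[x, y]\<close>; its off-diagonal entries do
      not enter the second defect.\<close>
    define dA dB where "dA = defectA a b a' b'" and "dB = defectB a b a' b'"
    define p q where "p = commutator (*) a a' + mn m n' - mn m' n"
      and "q = commutator (*) b b' + nm n m' - nm n' m"
    define k l where "k = fst (snd (gm_bracket x y))" and "l = fst (snd (snd (gm_bracket x y)))"
    have w: "gm_bracket x y = (p, k, l, q)"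
      by (simp add: x y k_def l_def gm_bracket_eq p_def q_def commutator_def algebra_simps)
    obtain va vm vn vb where v: "gm_bracket (block_map x) y = (va, vm, vn, vb)"
      by (cases "gm_bracket (block_map x) y")
    have bw: "block_map (p, k, l, q) = (va + dA, vm, vn, vb + dB)"
      using block_map_bracket[of a m n b a' m' n' b'] v
      by (simp flip: w x y add: dA_def dB_def)
    have "block_map (gm_bracket (gm_bracket x y) z) =
        gm_bracket (va + dA, vm, vn, vb + dB) z + (defectA p q a'' b'', 0, 0, defectB p q a'' b'')"
      by (simp add: w z block_map_bracket bw)
    also have "\<dots> = gm_bracket (va, vm, vn, vb) z +
       (defectA p q a'' b'' + commutator (*) dA a'', lM dA m'' - rM m'' dB,
        lN dB n'' - rN n'' dA, defectB p q a'' b'' + commutator (*) dB b'')"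
      by (simp add: z gm_bracket_eq commutator_def pairing_add algebra_simps)
    also have "\<dots> = gm_bracket (va, vm, vn, vb) z + (0, 0, 0, 0)"
      using defect_cancel[of a a' m n' m' n b b' a'' b''] D.defect_cancel[of b b' n m' n' m a a' b'' a'']
        defect_commutes[of a b a' b' m''] D.defect_commutes[of b a b' a' n'']
      by (simp add: dA_def dB_def p_def q_def defect_dual)
    finally show ?thesis
      by (simp add: v flip: zero_prod_def)
  qed
  then show ?thesis
    by (simp add: lie_triple_centralizer_def block_map_linear)
qed

end

section \<open>The conditions are necessary\<close>

locale unital_lie_triple_centralizer =
  morita_context scaleA scaleB scaleM scaleN lM rM lN rN mn nm
  for scaleA :: "'r::comm_ring_1 \<Rightarrow> 'a::ring \<Rightarrow> 'a"
    and scaleB :: "'r \<Rightarrow> 'b::ring \<Rightarrow> 'b"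
    and scaleM :: "'r \<Rightarrow> 'm::ab_group_add \<Rightarrow> 'm"
    and scaleN :: "'r \<Rightarrow> 'n::ab_group_add \<Rightarrow> 'n"
    and lM :: "'a \<Rightarrow> 'm \<Rightarrow> 'm" and rM :: "'m \<Rightarrow> 'b \<Rightarrow> 'm"
    and lN :: "'b \<Rightarrow> 'n \<Rightarrow> 'n" and rN :: "'n \<Rightarrow> 'a \<Rightarrow> 'n"
    and mn :: "'m \<Rightarrow> 'n \<Rightarrow> 'a" and nm :: "'n \<Rightarrow> 'm \<Rightarrow> 'b" +
  fixes oneA :: 'a and oneB :: 'b
    and \<phi> :: "'a \<times> 'm \<times> 'n \<times> 'b \<Rightarrow> 'a \<times> 'm \<times> 'n \<times> 'b"
  assumes oneA: "oneA * a = a" "a * oneA = a"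
    and oneB: "oneB * b = b" "b * oneB = b"
    and oneM: "lM oneA m = m" "rM m oneB = m"
    and oneN: "lN oneB n = n" "rN n oneA = n"
    and ltc: "lie_triple_centralizer (gm_scale scaleA scaleB scaleM scaleN)
                (gm_mult lM rM lN rN mn nm) \<phi>"
begin

sublocale \<phi>: module_hom "gm_scale scaleA scaleB scaleM scaleN"
    "gm_scale scaleA scaleB scaleM scaleN" \<phi>
  using ltc by (simp add: lie_triple_centralizer_def)

lemma slot1: "\<phi> (gm_bracket (gm_bracket x y) z) = gm_bracket (gm_bracket (\<phi> x) y) z"
  using ltc unfolding lie_triple_centralizer_def by blast

lemmas slot2 = assoc_algebra.lie_triple_centralizer_second[OF gm_assoc_algebra ltc]
lemmas slot3 = assoc_algebra.lie_triple_centralizer_third[OF gm_assoc_algebra ltc]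

definition \<alpha>\<^sub>1 where "\<alpha>\<^sub>1 a = fst (\<phi> (a, 0, 0, 0))"
definition \<alpha>\<^sub>4 where "\<alpha>\<^sub>4 a = snd (snd (snd (\<phi> (a, 0, 0, 0))))"
definition \<beta>\<^sub>1 where "\<beta>\<^sub>1 b = fst (\<phi> (0, 0, 0, b))"
definition \<beta>\<^sub>4 where "\<beta>\<^sub>4 b = snd (snd (snd (\<phi> (0, 0, 0, b))))"
definition \<tau>\<^sub>2 where "\<tau>\<^sub>2 m = fst (snd (\<phi> (0, m, 0, 0)))"
definition \<gamma>\<^sub>3 where "\<gamma>\<^sub>3 n = fst (snd (snd (\<phi> (0, 0, n, 0))))"

lemmas bracket_simps = gm_bracket_eq pairing_zero pairing_neg oneA oneB oneM oneN

lemma \<phi>_0: "\<phi> (0, 0, 0, 0) = (0, 0, 0, 0)"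
  using \<phi>.zero by (simp add: zero_prod_def)

text \<open>
  The reason for using \<open>1\<^sub>B\<close>: a double commutator that is preserved by \<open>\<phi>\<close> in its first
  slot and annihilates exactly the diagonal.
\<close>

lemma off_diagonal_part:
  "gm_bracket (gm_bracket (a, m, n, b) (0, 0, 0, oneB)) (0, 0, 0, oneB) = (0, m, n, 0)"
  by (simp add: bracket_simps)

lemma \<phi>_diagonal: "\<exists>a' b'. \<phi> (a, 0, 0, b) = (a', 0, 0, b')"
proof -
  obtain a' m' n' b' where eq: "\<phi> (a, 0, 0, b) = (a', m', n', b')"
    by (cases "\<phi> (a, 0, 0, b)")
  have "(0, m', n', 0) = \<phi> (0, 0, 0, 0)"
    using slot1[of "(a, 0, 0, b)" "(0, 0, 0, oneB)" "(0, 0, 0, oneB)"]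
    by (simp add: eq off_diagonal_part)
  then show ?thesis
    by (simp add: eq \<phi>_0)
qed

lemma \<phi>_A: "\<phi> (a, 0, 0, 0) = (\<alpha>\<^sub>1 a, 0, 0, \<alpha>\<^sub>4 a)"
  using \<phi>_diagonal[of a 0] by (auto simp: \<alpha>\<^sub>1_def \<alpha>\<^sub>4_def)

lemma \<phi>_B: "\<phi> (0, 0, 0, b) = (\<beta>\<^sub>1 b, 0, 0, \<beta>\<^sub>4 b)"
  using \<phi>_diagonal[of 0 b] by (auto simp: \<beta>\<^sub>1_def \<beta>\<^sub>4_def)

text \<open>
  An element \<open>m\<close> of \<open>M\<close> equals \<open>[[1\<^sub>A, m], 1\<^sub>B]\<close>. Transporting \<open>\<phi>\<close> to the diagonal
  element \<open>1\<^sub>A\<close>, rather than to \<open>m\<close>, excludes a component in \<open>N\<close>.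
\<close>

lemma \<phi>_M: "\<phi> (0, m, 0, 0) = (0, \<tau>\<^sub>2 m, 0, 0)"
proof -
  have "\<phi> (0, m, 0, 0) = (0, lM (\<alpha>\<^sub>1 oneA) m - rM m (\<alpha>\<^sub>4 oneA), 0, 0)"
    using slot1[of "(oneA, 0, 0, 0)" "(0, m, 0, 0)" "(0, 0, 0, oneB)"]
    by (simp add: bracket_simps \<phi>_A)
  then show ?thesis
    by (simp add: \<tau>\<^sub>2_def)
qed

lemma \<phi>_N: "\<phi> (0, 0, n, 0) = (0, 0, \<gamma>\<^sub>3 n, 0)"
proof -
  have "\<phi> (0, 0, n, 0) = (0, 0, rN n (\<alpha>\<^sub>1 oneA) - lN (\<alpha>\<^sub>4 oneA) n, 0)"
    using slot1[of "(oneA, 0, 0, 0)" "(0, 0, n, 0)" "(0, 0, 0, oneB)"]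
    by (simp add: bracket_simps \<phi>_A)
  then show ?thesis
    by (simp add: \<gamma>\<^sub>3_def)
qed

lemma \<phi>_split: "\<phi> (a, m, n, b) = (\<alpha>\<^sub>1 a + \<beta>\<^sub>1 b, \<tau>\<^sub>2 m, \<gamma>\<^sub>3 n, \<alpha>\<^sub>4 a + \<beta>\<^sub>4 b)"
proof -
  have "\<phi> (a, m, n, b) =
      \<phi> (a, 0, 0, 0) + \<phi> (0, m, 0, 0) + \<phi> (0, 0, n, 0) + \<phi> (0, 0, 0, b)"
    by (simp flip: \<phi>.add)
  then show ?thesis
    by (simp add: \<phi>_A \<phi>_B \<phi>_M \<phi>_N)
qed

lemma entries_linear:
  "module_hom scaleA scaleA \<alpha>\<^sub>1" "module_hom scaleA scaleB \<alpha>\<^sub>4"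
  "module_hom scaleB scaleA \<beta>\<^sub>1" "module_hom scaleB scaleB \<beta>\<^sub>4"
  "module_hom scaleM scaleM \<tau>\<^sub>2" "module_hom scaleN scaleN \<gamma>\<^sub>3"
proof -
  have add: "\<alpha>\<^sub>1 (a + a') = \<alpha>\<^sub>1 a + \<alpha>\<^sub>1 a'" "\<alpha>\<^sub>4 (a + a') = \<alpha>\<^sub>4 a + \<alpha>\<^sub>4 a'"
    "\<beta>\<^sub>1 (b + b') = \<beta>\<^sub>1 b + \<beta>\<^sub>1 b'" "\<beta>\<^sub>4 (b + b') = \<beta>\<^sub>4 b + \<beta>\<^sub>4 b'"
    "\<tau>\<^sub>2 (m + m') = \<tau>\<^sub>2 m + \<tau>\<^sub>2 m'" "\<gamma>\<^sub>3 (n + n') = \<gamma>\<^sub>3 n + \<gamma>\<^sub>3 n'"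
    for a a' b b' m m' n n'
    using \<phi>.add[of "(a, 0, 0, 0)" "(a', 0, 0, 0)"] \<phi>.add[of "(0, 0, 0, b)" "(0, 0, 0, b')"]
      \<phi>.add[of "(0, m, 0, 0)" "(0, m', 0, 0)"] \<phi>.add[of "(0, 0, n, 0)" "(0, 0, n', 0)"]
    by (simp_all add: \<phi>_A \<phi>_B \<phi>_M \<phi>_N)
  have scale: "\<alpha>\<^sub>1 (scaleA r a) = scaleA r (\<alpha>\<^sub>1 a)" "\<alpha>\<^sub>4 (scaleA r a) = scaleB r (\<alpha>\<^sub>4 a)"
    "\<beta>\<^sub>1 (scaleB r b) = scaleA r (\<beta>\<^sub>1 b)" "\<beta>\<^sub>4 (scaleB r b) = scaleB r (\<beta>\<^sub>4 b)"
    "\<tau>\<^sub>2 (scaleM r m) = scaleM r (\<tau>\<^sub>2 m)" "\<gamma>\<^sub>3 (scaleN r n) = scaleN r (\<gamma>\<^sub>3 n)"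
    for r a b m n
    using \<phi>.scale[of r "(a, 0, 0, 0)"] \<phi>.scale[of r "(0, 0, 0, b)"]
      \<phi>.scale[of r "(0, m, 0, 0)"] \<phi>.scale[of r "(0, 0, n, 0)"]
    by (simp_all add: \<phi>_A \<phi>_B \<phi>_M \<phi>_N)
  show "module_hom scaleA scaleA \<alpha>\<^sub>1" "module_hom scaleA scaleB \<alpha>\<^sub>4"
    "module_hom scaleB scaleA \<beta>\<^sub>1" "module_hom scaleB scaleB \<beta>\<^sub>4"
    "module_hom scaleM scaleM \<tau>\<^sub>2" "module_hom scaleN scaleN \<gamma>\<^sub>3"
    by (unfold_locales; simp add: add scale)+
qed

text \<open>
  Since the two corners annihilate each other, \<open>[[\<phi> a\<^sub>1, a\<^sub>2], a\<^sub>3]\<close> sees only the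
  \<open>A\<close>-entry of \<open>\<phi> a\<^sub>1\<close> and has no \<open>B\<close>-entry. The last two equations come from
  \<open>[a, b\<^sub>1] = 0\<close> and \<open>[b, a\<^sub>1] = 0\<close>.
\<close>

lemma corner_conditions:
  "\<alpha>\<^sub>1 (commutator (*) (commutator (*) a\<^sub>1 a\<^sub>2) a\<^sub>3) = commutator (*) (commutator (*) (\<alpha>\<^sub>1 a\<^sub>1) a\<^sub>2) a\<^sub>3"
  "\<alpha>\<^sub>4 (commutator (*) (commutator (*) a\<^sub>1 a\<^sub>2) a\<^sub>3) = 0"
  "\<beta>\<^sub>4 (commutator (*) (commutator (*) b\<^sub>1 b\<^sub>2) b\<^sub>3) = commutator (*) (commutator (*) (\<beta>\<^sub>4 b\<^sub>1) b\<^sub>2) b\<^sub>3"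
  "\<beta>\<^sub>1 (commutator (*) (commutator (*) b\<^sub>1 b\<^sub>2) b\<^sub>3) = 0"
  "commutator (*) (commutator (*) (\<alpha>\<^sub>4 a) b\<^sub>1) b\<^sub>2 = 0"
  "commutator (*) (commutator (*) (\<beta>\<^sub>1 b) a\<^sub>1) a\<^sub>2 = 0"
  using slot1[of "(a\<^sub>1, 0, 0, 0)" "(a\<^sub>2, 0, 0, 0)" "(a\<^sub>3, 0, 0, 0)"]
    slot1[of "(0, 0, 0, b\<^sub>1)" "(0, 0, 0, b\<^sub>2)" "(0, 0, 0, b\<^sub>3)"]
    slot1[of "(a, 0, 0, 0)" "(0, 0, 0, b\<^sub>1)" "(0, 0, 0, b\<^sub>2)"]
    slot1[of "(0, 0, 0, b)" "(a\<^sub>1, 0, 0, 0)" "(a\<^sub>2, 0, 0, 0)"]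
  by (simp_all add: bracket_simps \<phi>_A \<phi>_B \<phi>_0 commutator_def[where mult = times])

lemma corner_lie_triple_centralizers:
  "lie_triple_centralizer scaleA (*) \<alpha>\<^sub>1" "lie_triple_centralizer scaleB (*) \<beta>\<^sub>4"
  by (simp_all add: lie_triple_centralizer_def entries_linear corner_conditions)

text \<open>
  As \<open>[1\<^sub>A, m] = m\<close>, the double commutator of \<open>1\<^sub>A\<close>, \<open>m\<close>, \<open>n\<close> is the diagonal matrix
  with entries \<open>m n\<close> and \<open>- n m\<close>; \<open>\<phi>\<close> is moved to \<open>m\<close> and to \<open>n\<close>.
\<close>

lemma pairing_conditions:
  "\<alpha>\<^sub>1 (mn m n) - \<beta>\<^sub>1 (nm n m) = mn (\<tau>\<^sub>2 m) n" "mn (\<tau>\<^sub>2 m) n = mn m (\<gamma>\<^sub>3 n)"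
  "\<beta>\<^sub>4 (nm n m) - \<alpha>\<^sub>4 (mn m n) = nm (\<gamma>\<^sub>3 n) m" "nm (\<gamma>\<^sub>3 n) m = nm n (\<tau>\<^sub>2 m)"
  using slot2[of "(oneA, 0, 0, 0)" "(0, m, 0, 0)" "(0, 0, n, 0)"]
    slot3[of "(oneA, 0, 0, 0)" "(0, m, 0, 0)" "(0, 0, n, 0)"]
  by (auto simp: bracket_simps \<phi>_split \<phi>_M \<phi>_N entries_linear[THEN module_hom.neg]
      entries_linear[THEN module_hom.zero] algebra_simps)
    (metis add_left_cancel)

text \<open>
  Bracketing with \<open>1\<^sub>B\<close> is the identity on \<open>M\<close> and minus the identity on \<open>N\<close>. So \<open>a m\<close>,
  \<open>m b\<close>, \<open>n a\<close> and \<open>b n\<close> are double commutators with third entry \<open>1\<^sub>B\<close>, the two signs in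
  the case of \<open>N\<close> cancelling; for each, \<open>\<phi>\<close> is moved to the first and to the second entry.
\<close>

lemma action_conditions:
  "\<tau>\<^sub>2 (lM a m) = lM a (\<tau>\<^sub>2 m)" "lM a (\<tau>\<^sub>2 m) = lM (\<alpha>\<^sub>1 a) m - rM m (\<alpha>\<^sub>4 a)"
  "\<tau>\<^sub>2 (rM m b) = rM (\<tau>\<^sub>2 m) b" "rM (\<tau>\<^sub>2 m) b = rM m (\<beta>\<^sub>4 b) - lM (\<beta>\<^sub>1 b) m"
  "\<gamma>\<^sub>3 (rN n a) = rN (\<gamma>\<^sub>3 n) a" "rN (\<gamma>\<^sub>3 n) a = rN n (\<alpha>\<^sub>1 a) - lN (\<alpha>\<^sub>4 a) n"
  "\<gamma>\<^sub>3 (lN b n) = lN b (\<gamma>\<^sub>3 n)" "lN b (\<gamma>\<^sub>3 n) = lN (\<beta>\<^sub>4 b) n - rN n (\<beta>\<^sub>1 b)"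
  using slot1[of "(a, 0, 0, 0)" "(0, m, 0, 0)" "(0, 0, 0, oneB)"]
    slot2[of "(a, 0, 0, 0)" "(0, m, 0, 0)" "(0, 0, 0, oneB)"]
    slot1[of "(0, m, 0, 0)" "(0, 0, 0, b)" "(0, 0, 0, oneB)"]
    slot2[of "(0, m, 0, 0)" "(0, 0, 0, b)" "(0, 0, 0, oneB)"]
    slot1[of "(a, 0, 0, 0)" "(0, 0, n, 0)" "(0, 0, 0, oneB)"]
    slot2[of "(a, 0, 0, 0)" "(0, 0, n, 0)" "(0, 0, 0, oneB)"]
    slot1[of "(0, 0, n, 0)" "(0, 0, 0, b)" "(0, 0, 0, oneB)"]
    slot2[of "(0, 0, n, 0)" "(0, 0, 0, b)" "(0, 0, 0, oneB)"]
  by (simp_all add: bracket_simps \<phi>_A \<phi>_B \<phi>_M \<phi>_N)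

sublocale block_lie_centralizer scaleA scaleB scaleM scaleN lM rM lN rN mn nm
    \<alpha>\<^sub>1 \<beta>\<^sub>1 \<tau>\<^sub>2 \<alpha>\<^sub>4 \<beta>\<^sub>4 \<gamma>\<^sub>3
  by (rule block_lie_centralizer.intro[OF morita_context_axioms block_lie_centralizer_axioms.intro])
    (rule entries_linear corner_lie_triple_centralizers corner_conditions pairing_conditions
      action_conditions)+

end

theorem theorem3p1:
  fixes scaleA :: "'r::comm_ring_1 \<Rightarrow> 'a::ring \<Rightarrow> 'a"
    and scaleB :: "'r \<Rightarrow> 'b::ring \<Rightarrow> 'b"
    and scaleM :: "'r \<Rightarrow> 'm::ab_group_add \<Rightarrow> 'm"
    and scaleN :: "'r \<Rightarrow> 'n::ab_group_add \<Rightarrow> 'n"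
    and lM :: "'a \<Rightarrow> 'm \<Rightarrow> 'm" and rM :: "'m \<Rightarrow> 'b \<Rightarrow> 'm"
    and lN :: "'b \<Rightarrow> 'n \<Rightarrow> 'n" and rN :: "'n \<Rightarrow> 'a \<Rightarrow> 'n"
    and mn :: "'m \<Rightarrow> 'n \<Rightarrow> 'a" and nm :: "'n \<Rightarrow> 'm \<Rightarrow> 'b"
    and \<phi> :: "'a \<times> 'm \<times> 'n \<times> 'b \<Rightarrow> 'a \<times> 'm \<times> 'n \<times> 'b"
  assumes morita: "morita_context scaleA scaleB scaleM scaleN lM rM lN rN mn nm"
    and unital: "has_identity (gm_mult lM rM lN rN mn nm)"
    and linear: "module_hom (gm_scale scaleA scaleB scaleM scaleN)
                   (gm_scale scaleA scaleB scaleM scaleN) \<phi>"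
  shows "lie_triple_centralizer (gm_scale scaleA scaleB scaleM scaleN)
           (gm_mult lM rM lN rN mn nm) \<phi> \<longleftrightarrow>
    (\<exists>(\<alpha>\<^sub>1 :: 'a \<Rightarrow> 'a) (\<beta>\<^sub>1 :: 'b \<Rightarrow> 'a) (\<tau>\<^sub>2 :: 'm \<Rightarrow> 'm)
      (\<alpha>\<^sub>4 :: 'a \<Rightarrow> 'b) (\<beta>\<^sub>4 :: 'b \<Rightarrow> 'b) (\<gamma>\<^sub>3 :: 'n \<Rightarrow> 'n).
      module_hom scaleA scaleA \<alpha>\<^sub>1 \<and> module_hom scaleB scaleA \<beta>\<^sub>1 \<and>
      module_hom scaleM scaleM \<tau>\<^sub>2 \<and> module_hom scaleA scaleB \<alpha>\<^sub>4 \<and>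
      module_hom scaleB scaleB \<beta>\<^sub>4 \<and> module_hom scaleN scaleN \<gamma>\<^sub>3 \<and>
      range \<beta>\<^sub>1 \<subseteq> commutant (*) (commutators (*)) \<and>
      range \<alpha>\<^sub>4 \<subseteq> commutant (*) (commutators (*)) \<and>
      (\<forall>a m n b. \<phi> (a, m, n, b) = (\<alpha>\<^sub>1 a + \<beta>\<^sub>1 b, \<tau>\<^sub>2 m, \<gamma>\<^sub>3 n, \<alpha>\<^sub>4 a + \<beta>\<^sub>4 b)) \<and>
      \<comment> \<open>(i)\<close>
      lie_triple_centralizer scaleA (*) \<alpha>\<^sub>1 \<and>
      (\<forall>a b\<^sub>1 b\<^sub>2. commutator (*) (commutator (*) (\<alpha>\<^sub>4 a) b\<^sub>1) b\<^sub>2 = 0) \<and>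
      (\<forall>a\<^sub>1 a\<^sub>2 a\<^sub>3. \<alpha>\<^sub>4 (commutator (*) (commutator (*) a\<^sub>1 a\<^sub>2) a\<^sub>3) = 0) \<and>
      (\<forall>m n. \<alpha>\<^sub>1 (mn m n) - \<beta>\<^sub>1 (nm n m) = mn (\<tau>\<^sub>2 m) n \<and> mn (\<tau>\<^sub>2 m) n = mn m (\<gamma>\<^sub>3 n)) \<and>
      \<comment> \<open>(ii)\<close>
      lie_triple_centralizer scaleB (*) \<beta>\<^sub>4 \<and>
      (\<forall>b a\<^sub>1 a\<^sub>2. commutator (*) (commutator (*) (\<beta>\<^sub>1 b) a\<^sub>1) a\<^sub>2 = 0) \<and>
      (\<forall>b\<^sub>1 b\<^sub>2 b\<^sub>3. \<beta>\<^sub>1 (commutator (*) (commutator (*) b\<^sub>1 b\<^sub>2) b\<^sub>3) = 0) \<and>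
      (\<forall>m n. \<beta>\<^sub>4 (nm n m) - \<alpha>\<^sub>4 (mn m n) = nm n (\<tau>\<^sub>2 m) \<and> nm n (\<tau>\<^sub>2 m) = nm (\<gamma>\<^sub>3 n) m) \<and>
      \<comment> \<open>(iii)\<close>
      (\<forall>a m. \<tau>\<^sub>2 (lM a m) = lM a (\<tau>\<^sub>2 m) \<and> lM a (\<tau>\<^sub>2 m) = lM (\<alpha>\<^sub>1 a) m - rM m (\<alpha>\<^sub>4 a)) \<and>
      (\<forall>b m. \<tau>\<^sub>2 (rM m b) = rM (\<tau>\<^sub>2 m) b \<and> rM (\<tau>\<^sub>2 m) b = rM m (\<beta>\<^sub>4 b) - lM (\<beta>\<^sub>1 b) m) \<and>
      \<comment> \<open>(iv)\<close>
      (\<forall>a n. \<gamma>\<^sub>3 (rN n a) = rN (\<gamma>\<^sub>3 n) a \<and> rN (\<gamma>\<^sub>3 n) a = rN n (\<alpha>\<^sub>1 a) - lN (\<alpha>\<^sub>4 a) n) \<and>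
      (\<forall>b n. \<gamma>\<^sub>3 (lN b n) = lN b (\<gamma>\<^sub>3 n) \<and> lN b (\<gamma>\<^sub>3 n) = lN (\<beta>\<^sub>4 b) n - rN n (\<beta>\<^sub>1 b)))"
  (is "?ltc \<longleftrightarrow> ?blocks")
proof
  assume ltc: ?ltc
  interpret morita_context scaleA scaleB scaleM scaleN lM rM lN rN mn nm
    by (rule morita)
  obtain oneA oneB where "\<forall>a. oneA * a = a \<and> a * oneA = a" "\<forall>b. oneB * b = b \<and> b * oneB = b"
    "\<forall>m. lM oneA m = m \<and> rM m oneB = m" "\<forall>n. lN oneB n = n \<and> rN n oneA = n"
    using unital unfolding gm_has_identity_iff by blast
  then interpret U: unital_lie_triple_centralizer scaleA scaleB scaleM scaleN lM rM lN rN mn nm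
    oneA oneB \<phi>
    using ltc by unfold_locales simp_all
  show ?blocks
    by (rule exI[of _ U.\<alpha>\<^sub>1], rule exI[of _ U.\<beta>\<^sub>1], rule exI[of _ U.\<tau>\<^sub>2],
        rule exI[of _ U.\<alpha>\<^sub>4], rule exI[of _ U.\<beta>\<^sub>4], rule exI[of _ U.\<gamma>\<^sub>3])
      (intro conjI allI U.entries_linear U.range_\<beta>\<^sub>1 U.range_\<alpha>\<^sub>4 U.\<phi>_split U.ltc_\<alpha>\<^sub>1 U.ltc_\<beta>\<^sub>4
        U.corner_conditions U.pairing_conditions U.action_conditions
        U.pairing_conditions(3)[unfolded U.pairing_conditions(4)] U.pairing_conditions(4)[symmetric])
next
  assume ?blocks
  then show ?ltc
  proof (elim exE conjE, goal_cases)
    case block: (1 \<alpha>\<^sub>1 \<beta>\<^sub>1 \<tau>\<^sub>2 \<alpha>\<^sub>4 \<beta>\<^sub>4 \<gamma>\<^sub>3)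
    interpret B: block_lie_centralizer scaleA scaleB scaleM scaleN lM rM lN rN mn nm
        \<alpha>\<^sub>1 \<beta>\<^sub>1 \<tau>\<^sub>2 \<alpha>\<^sub>4 \<beta>\<^sub>4 \<gamma>\<^sub>3
      by (rule block_lie_centralizer.intro[OF morita block_lie_centralizer_axioms.intro])
        (simp_all only: block)
    have "\<phi> = B.block_map"
      by (auto simp: block B.block_map_def)
    then show ?case
      using B.lie_triple_centralizer_block_map by simp
  qed
qed

end
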